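(* Let $k \ge 4$. Regardless of who has the first move, a player (either of the two) in the $k$-regular graph game has a strategy to ensure that the resulting graph is Hamiltonian, i.e. contains a cycle passing through all of its vertices.
   Context: The $k$-regular graph game is a 2-person game played on $n$ vertices, starting from the empty graph (no edges). One at a time, each player draws one edge between any two vertices, under the condition that no vertex can have degree more than $k$. This continues until no player can draw an edge without making a vertex of degree greater than $k$. The resulting graph is the graph at the end of the game. *)

theory Defs
  imports Main
begin

text \<open>
  A position of the game is the set of edges drawn so far on the vertex set \<open>V\<close>; an edge is a
  two-element subset of \<open>V\<close>, so the graphs are simple.
\<close>

definition degree :: "'a set set \<Rightarrow> 'a \<Rightarrow> nat" where
  "degree E v = card {e \<in> E. v \<in> e}"

definition legal_move :: "'a set \<Rightarrow> nat \<Rightarrow> 'a set set \<Rightarrow> 'a set \<Rightarrow> bool" where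
  "legal_move V k E e \<longleftrightarrow>
     e \<subseteq> V \<and> card e = 2 \<and> e \<notin> E \<and> (\<forall>v\<in>V. degree (insert e E) v \<le> k)"

text \<open>The edges drawn, in chronological order.\<close>

inductive play :: "'a set \<Rightarrow> nat \<Rightarrow> 'a set list \<Rightarrow> bool" for V k where
  empty: "play V k []"
| move: "play V k es \<Longrightarrow> legal_move V k (set es) e \<Longrightarrow> play V k (es @ [e])"

definition complete_play :: "'a set \<Rightarrow> nat \<Rightarrow> 'a set list \<Rightarrow> bool" where
  "complete_play V k es \<longleftrightarrow> play V k es \<and> (\<nexists>e. legal_move V k (set es) e)"

datatype player = Alice | Bob

fun opponent :: "player \<Rightarrow> player" where
  "opponent Alice = Bob"
| "opponent Bob = Alice"

text \<open>The player to move after \<open>i\<close> edges have been drawn, if \<open>s\<close> has the first move.\<close>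

definition to_move :: "player \<Rightarrow> nat \<Rightarrow> player" where
  "to_move s i = (if even i then s else opponent s)"

text \<open>
  A candidate strategy maps the history of the game to the next edge to draw.
\<close>

definition follows :: "player \<Rightarrow> player \<Rightarrow> ('a set list \<Rightarrow> 'a set) \<Rightarrow> 'a set list \<Rightarrow> bool" where
  "follows s p \<sigma> es \<longleftrightarrow> (\<forall>i < length es. to_move s i = p \<longrightarrow> es ! i = \<sigma> (take i es))"

text \<open>
  Legality is demanded only at histories that can arise when \<open>p\<close> uses \<open>\<sigma>\<close>. Without this demand, a
  \<open>\<sigma>\<close> proposing an illegal edge would be consistent with no complete play, and so would vacuously
  ensure any outcome.
\<close>

definition strategy :: "'a set \<Rightarrow> nat \<Rightarrow> player \<Rightarrow> player \<Rightarrow> ('a set list \<Rightarrow> 'a set) \<Rightarrow> bool" where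
  "strategy V k s p \<sigma> \<longleftrightarrow>
     (\<forall>es. play V k es \<and> follows s p \<sigma> es \<and> \<not> complete_play V k es \<and> to_move s (length es) = p
        \<longrightarrow> legal_move V k (set es) (\<sigma> es))"

definition has_strategy_to_ensure ::
  "'a set \<Rightarrow> nat \<Rightarrow> player \<Rightarrow> player \<Rightarrow> ('a set set \<Rightarrow> bool) \<Rightarrow> bool" where
  "has_strategy_to_ensure V k s p P \<longleftrightarrow>
     (\<exists>\<sigma>. strategy V k s p \<sigma> \<and> (\<forall>es. complete_play V k es \<and> follows s p \<sigma> es \<longrightarrow> P (set es)))"

definition cycle :: "'a set set \<Rightarrow> 'a list \<Rightarrow> bool" where
  "cycle E xs \<longleftrightarrow> 3 \<le> length xs \<and> distinct xs \<and>
     (\<forall>i < length xs. {xs ! i, xs ! (Suc i mod length xs)} \<in> E)"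

definition hamiltonian :: "'a set \<Rightarrow> 'a set set \<Rightarrow> bool" where
  "hamiltonian V E \<longleftrightarrow> (\<exists>xs. cycle E xs \<and> set xs = V)"

end

theory Submission
  imports Defs
begin

text \<open>
  The player who wants a Hamiltonian graph keeps a cover of \<open>V\<close> by vertex-disjoint paths of the graph
  drawn so far and links two of them, end to end, at every turn. At the start every vertex is a path
  by itself; when a single path is left, the last link closes it to a Hamiltonian cycle. The only
  danger is that the opponent spends the degree of an end before it has been linked, and two
  observations remove it.

  First, a move of the opponent either joins ends of two different paths, in which case it is itself
  a link, or it touches the ends of at most one path and raises their degrees by at most one. So it
  leaves at most one path in a worse state than the others (\<open>capped_cover_after_attack\<close>).

  Second, the player can afford to keep every path in the state where one end has degree at
  most \<open>1\<close> and the other at most \<open>2\<close>, a single vertex having degree \<open>0\<close>. The opponent can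
  turn this into at most \<open>2\<close> and \<open>3\<close> on one path. The player answers by linking the worse end of this
  path to the worse end of another one: the two degrees become at most \<open>4\<close> and \<open>3\<close>, which is
  allowed since \<open>k \<ge> 4\<close>, and the ends of the new path are the better ends, of degrees at most \<open>2\<close>
  and \<open>1\<close> (\<open>reply_to_attack\<close>). If there is no other path, then the degrees \<open>2\<close> and \<open>3\<close> still permit
  the closing edge.

  No link is ever blocked by being drawn already: ends of different paths have been ends of
  different paths throughout, so an edge between them would have merged their paths when it was
  drawn. If the closing edge is drawn already, then the graph is Hamiltonian, and it remains so
  whatever is drawn later.
\<close>

section \<open>Strategies from invariants\<close>

lemma play_degree_le:
  assumes "play V k es" "v \<in> V"
  shows "degree (set es) v \<le> k"
  using assms by (induction rule: play.induct) (auto simp: degree_def legal_move_def)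

lemma follows_snoc:
  "follows s p \<sigma> (es @ [e]) \<longleftrightarrow>
     follows s p \<sigma> es \<and> (to_move s (length es) = p \<longrightarrow> e = \<sigma> es)"
  by (auto simp: follows_def nth_append less_Suc_eq)

lemma to_move_Suc: "to_move s (Suc i) = p \<longleftrightarrow> to_move s i \<noteq> p"
  by (cases s; cases p) (auto simp: to_move_def)

text \<open>
  The strategy looks only at the current graph: \<open>p\<close> is to move in positions of \<open>A\<close> and chooses any
  legal move into \<open>B\<close>, from where every move of the opponent leads back to \<open>A\<close>. The initial position
  is in both sets because either player may begin.
\<close>

lemma has_strategy_from_invariants:
  fixes V :: "'a set"
  assumes init: "A {}" "B {}"
    and reply: "\<And>es e. play V k es \<Longrightarrow> A (set es) \<Longrightarrow> legal_move V k (set es) e \<Longrightarrow>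
                  \<exists>e'. legal_move V k (set es) e' \<and> B (insert e' (set es))"
    and attack: "\<And>es e. play V k es \<Longrightarrow> B (set es) \<Longrightarrow> legal_move V k (set es) e \<Longrightarrow>
                  A (insert e (set es))"
    and final: "\<And>es. complete_play V k es \<Longrightarrow> A (set es) \<or> B (set es) \<Longrightarrow> P (set es)"
  shows "has_strategy_to_ensure V k s p P"
proof -
  define \<sigma> where "\<sigma> es = (SOME e. legal_move V k (set es) e \<and> B (insert e (set es)))"
    for es :: "'a set list"
  have \<sigma>: "legal_move V k (set es) (\<sigma> es) \<and> B (insert (\<sigma> es) (set es))"
    if "play V k es" "A (set es)" "legal_move V k (set es) e" for es e
    unfolding \<sigma>_def by (rule someI_ex) (use reply that in blast)
  have inv: "if to_move s (length es) = p then A (set es) else B (set es)"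
    if "play V k es" "follows s p \<sigma> es" for es
    using that
  proof (induction rule: play.induct)
    case empty
    then show ?case using init by simp
  next
    case (move es e)
    then show ?case
      using \<sigma>[of es e] attack[of es e]
      by (auto simp: follows_snoc to_move_Suc split: if_splits)
  qed
  have "strategy V k s p \<sigma>"
    unfolding strategy_def complete_play_def using inv \<sigma> by metis
  moreover have "P (set es)" if "complete_play V k es" "follows s p \<sigma> es" for es
    using inv[of es] final[of es] that unfolding complete_play_def by (metis (full_types))
  ultimately show ?thesis
    unfolding has_strategy_to_ensure_def by blast
qed

section \<open>Degrees and Hamiltonian cycles\<close>

lemma degree_empty [simp]: "degree {} v = 0"
  by (simp add: degree_def)

lemma degree_insert:
  assumes "finite E" "e \<notin> E"
  shows "degree (insert e E) v = degree E v + of_bool (v \<in> e)"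
proof -
  have "{e' \<in> insert e E. v \<in> e'} = (if v \<in> e then insert e else id) {e' \<in> E. v \<in> e'}"
    by auto
  then show ?thesis using assms by (auto simp: degree_def)
qed

lemma legal_moveI:
  assumes "finite E" "x \<in> V" "y \<in> V" "x \<noteq> y" "{x, y} \<notin> E" "\<forall>v\<in>V. degree E v \<le> k"
    and "degree E x < k" "degree E y < k"
  shows "legal_move V k E {x, y}"
  using assms by (auto simp: legal_move_def degree_insert)

lemma hamiltonian_mono: "hamiltonian V E \<Longrightarrow> E \<subseteq> E' \<Longrightarrow> hamiltonian V E'"
  unfolding hamiltonian_def cycle_def by blast

lemma hamiltonian_if_closed_path:
  assumes "successively (\<lambda>x y. {x, y} \<in> E) P" "distinct P" "set P = V" "3 \<le> length P"
    and "{hd P, last P} \<in> E"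
  shows "hamiltonian V E"
proof -
  have "{P ! i, P ! (Suc i mod length P)} \<in> E" if "i < length P" for i
  proof (cases "Suc i < length P")
    case True
    then show ?thesis using assms(1) by (simp add: successively_conv_nth)
  next
    case False
    then have i: "Suc i = length P" using that by simp
    have "P \<noteq> []" using that by auto
    moreover have "i = length P - 1" "Suc i mod length P = 0" using i by simp_all
    ultimately have "P ! i = last P" "Suc i mod length P = 0" "P ! 0 = hd P"
      by (simp_all add: last_conv_nth hd_conv_nth)
    then show ?thesis using assms(5) by (simp add: insert_commute)
  qed
  then show ?thesis using assms unfolding hamiltonian_def cycle_def by blast
qed

section \<open>Path covers\<close>

definition ends :: "'a list \<Rightarrow> 'a set" where
  "ends P = {hd P, last P}"

lemma ends_subset: "P \<noteq> [] \<Longrightarrow> ends P \<subseteq> set P"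
  by (simp add: ends_def)

text \<open>
  The last condition is what makes a link between any two of the paths a new edge, so that only the
  degrees of the linked ends decide whether it is legal.
\<close>

definition path_cover :: "'a set \<Rightarrow> 'a set set \<Rightarrow> 'a list set \<Rightarrow> bool" where
  "path_cover V E C \<longleftrightarrow>
     \<Union>(set ` C) = V \<and>
     (\<forall>P\<in>C. P \<noteq> [] \<and> distinct P \<and> successively (\<lambda>x y. {x, y} \<in> E) P) \<and>
     (\<forall>P\<in>C. \<forall>Q\<in>C. P \<noteq> Q \<longrightarrow> set P \<inter> set Q = {} \<and> (\<forall>x\<in>ends P. \<forall>y\<in>ends Q. {x, y} \<notin> E))"

lemma path_coverI:
  assumes "\<Union>(set ` C) = V"
    and "\<And>P. P \<in> C \<Longrightarrow> P \<noteq> [] \<and> distinct P \<and> successively (\<lambda>x y. {x, y} \<in> E) P"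
    and "\<And>P Q. P \<in> C \<Longrightarrow> Q \<in> C \<Longrightarrow> P \<noteq> Q \<Longrightarrow> set P \<inter> set Q = {}"
    and "\<And>P Q x y. P \<in> C \<Longrightarrow> Q \<in> C \<Longrightarrow> P \<noteq> Q \<Longrightarrow> x \<in> ends P \<Longrightarrow> y \<in> ends Q \<Longrightarrow> {x, y} \<notin> E"
  shows "path_cover V E C"
  using assms unfolding path_cover_def by (intro conjI ballI impI) simp_all

lemma path_coverD:
  assumes "path_cover V E C" "P \<in> C"
  shows "P \<noteq> []" "distinct P" "successively (\<lambda>x y. {x, y} \<in> E) P" "set P \<subseteq> V" "ends P \<subseteq> set P"
  using assms ends_subset[of P] by (auto simp: path_cover_def)

lemma path_cover_disjoint:
  assumes "path_cover V E C" "P \<in> C" "Q \<in> C" "P \<noteq> Q"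
  shows "set P \<inter> set Q = {}"
  using assms unfolding path_cover_def by blast

lemma path_cover_separated:
  assumes "path_cover V E C" "P \<in> C" "Q \<in> C" "P \<noteq> Q" "x \<in> ends P" "y \<in> ends Q"
  shows "{x, y} \<notin> E"
  using assms unfolding path_cover_def by blast

lemma path_cover_singletons: "path_cover V {} ((\<lambda>v. [v]) ` V)"
  unfolding path_cover_def by auto

lemma path_cover_insert_edge:
  assumes cov: "path_cover V E C"
    and no_link: "\<And>P Q x y. P \<in> C \<Longrightarrow> Q \<in> C \<Longrightarrow> P \<noteq> Q \<Longrightarrow> x \<in> ends P \<Longrightarrow> y \<in> ends Q \<Longrightarrow> e \<noteq> {x, y}"
  shows "path_cover V (insert e E) C"
proof (rule path_coverI)
  show "\<Union>(set ` C) = V" using cov unfolding path_cover_def by blast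
  show "P \<noteq> [] \<and> distinct P \<and> successively (\<lambda>x y. {x, y} \<in> insert e E) P" if "P \<in> C" for P
    using path_coverD(1-3)[OF cov that] by (auto intro: successively_mono[of "\<lambda>x y. {x, y} \<in> E"])
  show "set P \<inter> set Q = {}" if "P \<in> C" "Q \<in> C" "P \<noteq> Q" for P Q
    using path_cover_disjoint[OF cov that] .
  show "{x, y} \<notin> insert e E"
    if "P \<in> C" "Q \<in> C" "P \<noteq> Q" "x \<in> ends P" "y \<in> ends Q" for P Q x y
    using path_cover_separated[OF cov that] no_link[OF that] by simp
qed

lemma path_ending_at:
  assumes "P \<noteq> []" "distinct P" "successively (\<lambda>x y. {x, y} \<in> E) P" "ends P = {x, x'}"
  obtains P' where "hd P' = x'" "last P' = x" "P' \<noteq> []" "distinct P'" "set P' = set P"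
    "successively (\<lambda>x y. {x, y} \<in> E) P'"
proof (cases "last P = x \<and> hd P = x'")
  case True
  then show ?thesis using assms that by blast
next
  case False
  then have "last P = x'" "hd P = x"
    using assms(4) by (auto simp: ends_def doubleton_eq_iff)
  moreover have "successively (\<lambda>x y. {x, y} \<in> E) (rev P)"
    using assms(3) by (simp add: insert_commute)
  ultimately show ?thesis
    using assms that[of "rev P"] by (simp add: hd_rev last_rev)
qed

lemma path_cover_link:
  assumes cov: "path_cover V E C" and PQ: "P \<in> C" "Q \<in> C" "P \<noteq> Q"
    and ends: "ends P = {x, x'}" "ends Q = {y, y'}"
  obtains R where "ends R = {x', y'}" "path_cover V (insert {x, y} E) (insert R (C - {P, Q}))"
proof -
  obtain P' where P': "hd P' = x'" "last P' = x" "P' \<noteq> []" "distinct P'" "set P' = set P"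
    "successively (\<lambda>x y. {x, y} \<in> E) P'"
    using path_ending_at[OF path_coverD(1-3)[OF cov PQ(1)] ends(1)] .
  obtain Q' where Q': "hd Q' = y" "last Q' = y'" "Q' \<noteq> []" "distinct Q'" "set Q' = set Q"
    "successively (\<lambda>x y. {x, y} \<in> E) Q'"
    using path_ending_at[OF path_coverD(1-3)[OF cov PQ(2)] ends(2)[unfolded insert_commute[of y]]] .
  let ?E = "insert {x, y} E" and ?R = "P' @ Q'" and ?C = "C - {P, Q}"
  have R_ends: "ends ?R = {x', y'}" "ends ?R \<subseteq> ends P \<union> ends Q"
    using P' Q' ends by (auto simp: ends_def[of ?R])
  have xy: "x \<in> set P" "y \<in> set Q"
    using path_coverD(5)[OF cov] PQ ends by auto
  have path: "successively (\<lambda>x y. {x, y} \<in> ?E) S"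
    if "successively (\<lambda>x y. {x, y} \<in> E) S" for S
    using that by (rule successively_mono) simp
  have R_path: "successively (\<lambda>x y. {x, y} \<in> ?E) ?R" "distinct ?R"
    using path[OF P'(6)] path[OF Q'(6)] P' Q' path_cover_disjoint[OF cov PQ]
    by (auto simp: successively_append_iff)
  \<comment> \<open>The new edge has no vertex on the paths that are left alone.\<close>
  have away: "{u, w} \<notin> ?E" "{w, u} \<notin> ?E"
    if "S \<in> insert P (insert Q C)" "T \<in> ?C" "S \<noteq> T" "u \<in> ends S" "w \<in> ends T" for S T u w
  proof -
    have "{u, w} \<notin> E"
      using path_cover_separated[OF cov _ _ that(3-5)] that PQ by auto
    moreover have "w \<noteq> x" "w \<noteq> y"
      using path_coverD(5)[OF cov, of T] path_cover_disjoint[OF cov, of P T]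
        path_cover_disjoint[OF cov, of Q T] that PQ xy by auto
    ultimately show "{u, w} \<notin> ?E" "{w, u} \<notin> ?E"
      by (auto simp: doubleton_eq_iff insert_commute)
  qed
  have R_away: "{u, w} \<notin> ?E" "{w, u} \<notin> ?E" if "S \<in> ?C" "u \<in> ends ?R" "w \<in> ends S" for S u w
    using away[of P S u w] away[of Q S u w] that R_ends(2) by auto
  have R_disjoint: "set ?R \<inter> set S = {}" "set S \<inter> set ?R = {}" if "S \<in> ?C" for S
    using path_cover_disjoint[OF cov, of P S] path_cover_disjoint[OF cov, of Q S] that PQ P' Q'
    by auto
  have "path_cover V ?E (insert ?R ?C)"
  proof (rule path_coverI)
    show "\<Union>(set ` insert ?R ?C) = V"
      using cov PQ P' Q' unfolding path_cover_def by auto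
    show "S \<noteq> [] \<and> distinct S \<and> successively (\<lambda>x y. {x, y} \<in> ?E) S" if "S \<in> insert ?R ?C" for S
      using R_path path_coverD(1-3)[OF cov, of S] path[of S] that P'(3) by auto
    show "set S \<inter> set T = {}" if "S \<in> insert ?R ?C" "T \<in> insert ?R ?C" "S \<noteq> T" for S T
    proof (cases "S = ?R \<or> T = ?R")
      case True
      then show ?thesis using R_disjoint[of S] R_disjoint[of T] that by blast
    next
      case False
      then show ?thesis using path_cover_disjoint[OF cov, of S T] that by blast
    qed
    show "{u, w} \<notin> ?E" if "S \<in> insert ?R ?C" "T \<in> insert ?R ?C" "S \<noteq> T"
      "u \<in> ends S" "w \<in> ends T" for S T u w
    proof (cases "S = ?R \<or> T = ?R")
      case True
      then show ?thesis using R_away[of T u w] R_away[of S w u] that by blast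
    next
      case False
      then show ?thesis using away[of S T u w] that by blast
    qed
  qed
  with R_ends(1) show ?thesis by (rule that)
qed

section \<open>Keeping the ends available\<close>

text \<open>
  A single vertex serves as both ends of its path and has to be linked twice. Its degree therefore
  counts one more than it is: this is the degree it will have as an end after the first link.
\<close>

definition capped :: "'a set set \<Rightarrow> nat \<Rightarrow> nat \<Rightarrow> 'a list \<Rightarrow> bool" where
  "capped E a b P \<longleftrightarrow> (\<exists>x y. ends P = {x, y} \<and>
     degree E x + of_bool (x = y) \<le> a \<and> degree E y + of_bool (x = y) \<le> b)"

text \<open>
  The player leaves positions with \<open>a = 1\<close> and \<open>b = 2\<close>, where no path is exceptional, and meets
  positions with \<open>a = 2\<close> and \<open>b = 3\<close>.
\<close>

definition capped_cover :: "'a set \<Rightarrow> nat \<Rightarrow> nat \<Rightarrow> 'a set set \<Rightarrow> bool" where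
  "capped_cover V a b E \<longleftrightarrow>
     (\<exists>C. path_cover V E C \<and> (\<exists>P\<in>C. capped E a b P \<and> (\<forall>Q\<in>C - {P}. capped E 1 2 Q)))"

lemma cappedE:
  assumes "capped E a b P"
  obtains x y where "ends P = {x, y}" "degree E x + of_bool (x = y) \<le> a"
    "degree E y + of_bool (x = y) \<le> b"
  using assms unfolding capped_def by blast

lemma capped_mono: "capped E a b P \<Longrightarrow> a \<le> a' \<Longrightarrow> b \<le> b' \<Longrightarrow> capped E a' b' P"
  unfolding capped_def by (meson le_trans)

lemma capped_cover_mono:
  "capped_cover V a b E \<Longrightarrow> a \<le> a' \<Longrightarrow> b \<le> b' \<Longrightarrow> capped_cover V a' b' E"
  unfolding capped_cover_def by (meson capped_mono)

lemma capped_insert_edge_away: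
  assumes "capped E a b P" "finite E" "e \<notin> E" "ends P \<inter> e = {}"
  shows "capped (insert e E) a b P"
  using assms unfolding capped_def by (fastforce simp: degree_insert)

lemma capped_insert_edge:
  assumes "capped E a b P" "finite E" "e \<notin> E"
  shows "capped (insert e E) (Suc a) (Suc b) P"
proof -
  obtain x y where "ends P = {x, y}" "degree E x + of_bool (x = y) \<le> a"
    "degree E y + of_bool (x = y) \<le> b"
    using assms(1) by (rule cappedE)
  then show ?thesis
    unfolding capped_def using assms by (intro exI[of _ x] exI[of _ y]) (auto simp: degree_insert)
qed

lemma capped_cover_empty: "V \<noteq> {} \<Longrightarrow> capped_cover V 1 2 {}"
  unfolding capped_cover_def
  by (rule exI[of _ "(\<lambda>v. [v]) ` V"]) (auto simp: path_cover_singletons capped_def ends_def)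

text \<open>
  After a link, the vertices \<open>x'\<close> and \<open>y'\<close> are the ends of the new path. If \<open>x' = x\<close>, then the link has
  raised the degree of \<open>x'\<close>, which is what the correction for single vertices has allowed for.
\<close>

lemma capped_cover_link:
  assumes cov: "path_cover V E C" and PQ: "P \<in> C" "Q \<in> C" "P \<noteq> Q"
    and ends: "ends P = {x, x'}" "ends Q = {y, y'}"
    and deg: "degree E x' + of_bool (x = x') \<le> a" "degree E y' + of_bool (y = y') \<le> b"
    and rest: "\<And>S. S \<in> C - {P, Q} \<Longrightarrow> capped E 1 2 S"
    and "finite E"
  shows "capped_cover V a b (insert {x, y} E)"
proof -
  obtain R where R: "ends R = {x', y'}"
    "path_cover V (insert {x, y} E) (insert R (C - {P, Q}))"
    using path_cover_link[OF cov PQ ends] .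
  have in_P: "{x, x'} \<subseteq> set P" and in_Q: "{y, y'} \<subseteq> set Q"
    using path_coverD(5)[OF cov] PQ ends by auto
  have ne: "x \<noteq> y" "x \<noteq> y'" "x' \<noteq> y" "x' \<noteq> y'"
    using path_cover_disjoint[OF cov PQ] in_P in_Q by auto
  have new: "{x, y} \<notin> E"
    using path_cover_separated[OF cov PQ] ends by auto
  have "capped (insert {x, y} E) a b R"
    unfolding capped_def using R(1) deg ne \<open>finite E\<close> new
    by (intro exI[of _ x'] exI[of _ y']) (auto simp: degree_insert)
  moreover have "capped (insert {x, y} E) 1 2 S" if "S \<in> C - {P, Q}" for S
  proof (rule capped_insert_edge_away)
    show "capped E 1 2 S" using rest that .
    show "ends S \<inter> {x, y} = {}"
      using path_coverD(5)[OF cov, of S] path_cover_disjoint[OF cov, of P S]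
        path_cover_disjoint[OF cov, of Q S] that PQ in_P in_Q by auto
  qed fact+
  ultimately show ?thesis
    unfolding capped_cover_def using R(2) by blast
qed

section \<open>The two kinds of moves\<close>

text \<open>
  A link by the opponent may well join the better ends of two paths. The ends of the new path are then
  the worse ones, of degree at most \<open>2\<close> each, which is within the bounds for the exceptional path.
\<close>

lemma capped_cover_after_attack:
  assumes good: "capped_cover V 1 2 E" and "finite E" "e \<notin> E" "card e = 2"
  shows "capped_cover V 2 3 (insert e E)"
proof -
  obtain C P\<^sub>0 where cov: "path_cover V E C" and "P\<^sub>0 \<in> C" and cap: "\<And>P. P \<in> C \<Longrightarrow> capped E 1 2 P"
    using good unfolding capped_cover_def by blast
  show ?thesis
  proof (cases "\<exists>P\<in>C. \<exists>Q\<in>C. P \<noteq> Q \<and> (\<exists>x\<in>ends P. \<exists>y\<in>ends Q. e = {x, y})")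
    case True
    then obtain P Q x y where PQ: "P \<in> C" "Q \<in> C" "P \<noteq> Q"
      and xy: "x \<in> ends P" "y \<in> ends Q" "e = {x, y}"
      by blast
    have other: "\<exists>z'. ends S = {z, z'} \<and> degree E z' + of_bool (z = z') \<le> 2"
      if "S \<in> C" "z \<in> ends S" for S z
      using cap[OF that(1)] that(2) by (elim cappedE) (fastforce split: if_splits)
    obtain x' y' where "ends P = {x, x'}" "degree E x' + of_bool (x = x') \<le> 2"
      "ends Q = {y, y'}" "degree E y' + of_bool (y = y') \<le> 2"
      using other PQ xy by meson
    then have "capped_cover V 2 2 (insert e E)"
      unfolding xy(3) using capped_cover_link[OF cov PQ] cap \<open>finite E\<close> by blast
    then show ?thesis by (rule capped_cover_mono) auto
  next
    case no_link: False
    then have cov': "path_cover V (insert e E) C"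
      by (intro path_cover_insert_edge[OF cov]) blast
    \<comment> \<open>An edge that contains ends of two paths consists of these two ends, so it is a link.\<close>
    have "\<exists>P\<in>C. \<forall>Q\<in>C - {P}. ends Q \<inter> e = {}"
    proof (cases "\<exists>P\<in>C. ends P \<inter> e \<noteq> {}")
      case True
      then obtain P x where P: "P \<in> C" "x \<in> ends P" "x \<in> e" by blast
      have "ends Q \<inter> e = {}" if Q: "Q \<in> C - {P}" for Q
      proof (rule ccontr)
        assume "ends Q \<inter> e \<noteq> {}"
        then obtain y where y: "y \<in> ends Q" "y \<in> e" by blast
        have "x \<noteq> y"
          using path_cover_disjoint[OF cov, of P Q] path_coverD(5)[OF cov] P Q y by blast
        then have "e = {x, y}"
          using P(3) y(2) \<open>card e = 2\<close> by (auto simp: card_2_iff)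
        then show False using no_link P Q y by blast
      qed
      then show ?thesis using P(1) by blast
    next
      case False
      then show ?thesis using \<open>P\<^sub>0 \<in> C\<close> by blast
    qed
    then obtain P where P: "P \<in> C" "\<And>Q. Q \<in> C - {P} \<Longrightarrow> ends Q \<inter> e = {}" by blast
    have "capped (insert e E) (Suc 1) (Suc 2) P"
      using capped_insert_edge[OF cap[OF P(1)]] assms by blast
    moreover have "capped (insert e E) 1 2 Q" if "Q \<in> C - {P}" for Q
      using capped_insert_edge_away[OF cap _ _ P(2)[OF that]] assms that by blast
    ultimately show ?thesis
      unfolding capped_cover_def using cov' P(1) by (auto simp: numeral_eq_Suc)
  qed
qed

text \<open>
  Linking the worse ends buries them in the interior of the new path, where their degrees no longer
  matter. This is where \<open>k \<ge> 4\<close> is needed: an end of degree \<open>3\<close> has to take one more edge. A single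
  path that covers at least three vertices closes to a cycle.
\<close>

lemma reply_to_attack:
  assumes "capped_cover V 2 3 E" "finite V" "card V \<ge> 3" "k \<ge> 4" "finite E"
    and deg_le: "\<forall>v\<in>V. degree E v \<le> k"
    and not_ham: "\<not> hamiltonian V E"
  shows "\<exists>e. legal_move V k E e \<and> (hamiltonian V (insert e E) \<or> capped_cover V 1 2 (insert e E))"
proof -
  obtain C P where cov: "path_cover V E C" and P: "P \<in> C" "capped E 2 3 P"
    and cap: "\<And>Q. Q \<in> C - {P} \<Longrightarrow> capped E 1 2 Q"
    using assms(1) unfolding capped_cover_def by blast
  obtain x' x where x: "ends P = {x', x}" "degree E x' + of_bool (x' = x) \<le> 2"
    "degree E x + of_bool (x' = x) \<le> 3"
    using P(2) by (rule cappedE)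
  note P_path = path_coverD[OF cov P(1)]
  have xV: "x \<in> V" "x' \<in> V" using P_path x(1) by auto
  show ?thesis
  proof (cases "C = {P}")
    case True
    then have "set P = V" using cov unfolding path_cover_def by simp
    then have len: "3 \<le> length P" using P_path(2) assms(3) by (metis distinct_card)
    have close: "hamiltonian V E'" if "E \<subseteq> E'" "{x', x} \<in> E'" for E'
    proof (rule hamiltonian_if_closed_path)
      show "successively (\<lambda>x y. {x, y} \<in> E') P"
        using P_path(3) by (rule successively_mono) (use that in auto)
      show "{hd P, last P} \<in> E'" using that x(1) by (simp add: ends_def)
    qed fact+
    have "{x', x} \<notin> E" using close[of E] not_ham by blast
    moreover have "x' \<noteq> x"
    proof
      assume "x' = x"
      then have "hd P = last P" using x(1) by (auto simp: ends_def)
      then have "P ! 0 = P ! (length P - 1)" using P_path(1) by (simp add: hd_conv_nth last_conv_nth)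
      moreover have "0 < length P" "length P - 1 < length P" "0 \<noteq> length P - 1" using len by auto
      ultimately show False
        using P_path(2) nth_eq_iff_index_eq by blast
    qed
    ultimately have "legal_move V k E {x', x}"
      using xV x deg_le assms by (intro legal_moveI) auto
    then show ?thesis using close[of "insert {x', x} E"] by blast
  next
    case False
    then obtain Q where Q: "Q \<in> C" "P \<noteq> Q" using P(1) by blast
    then have "capped E 1 2 Q" using cap by blast
    then obtain y' y where y: "ends Q = {y', y}" "degree E y' + of_bool (y' = y) \<le> 1"
      "degree E y + of_bool (y' = y) \<le> 2"
      by (rule cappedE)
    have "y \<in> V" using path_coverD[OF cov Q(1)] y(1) by auto
    have "{y, x} \<notin> E"
      using path_cover_separated[OF cov Q(1) P(1)] Q(2) x(1) y(1) by auto
    moreover have "y \<noteq> x"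
      using path_cover_disjoint[OF cov P(1) Q] path_coverD(5)[OF cov Q(1)] P_path(5) x(1) y(1)
      by auto
    ultimately have "legal_move V k E {y, x}"
      using xV \<open>y \<in> V\<close> x y deg_le assms by (intro legal_moveI) auto
    moreover have "capped_cover V 1 2 (insert {y, x} E)"
    proof (rule capped_cover_link[OF cov Q(1) P(1)])
      show "ends Q = {y, y'}" "ends P = {x, x'}" using x(1) y(1) by auto
      show "degree E y' + of_bool (y = y') \<le> 1" using y(2) by (simp add: eq_commute[of y])
      show "degree E x' + of_bool (x = x') \<le> 2" using x(2) by (simp add: eq_commute[of x])
    qed (use Q cap \<open>finite E\<close> in auto)
    ultimately show ?thesis by blast
  qed
qed

theorem theorem1p1:
  fixes V :: "'a set" and n k :: nat and s p :: player
  assumes "finite V" and "card V = n" and "n \<ge> 3" and "k \<ge> 4"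
  shows "has_strategy_to_ensure V k s p (hamiltonian V)"
proof (rule has_strategy_from_invariants[where
      A = "\<lambda>E. hamiltonian V E \<or> capped_cover V 2 3 E" and
      B = "\<lambda>E. hamiltonian V E \<or> capped_cover V 1 2 E"])
  have B_imp_A: "capped_cover V 2 3 E" if "capped_cover V 1 2 E" for E
    using that by (rule capped_cover_mono) auto
  have ham_insert: "hamiltonian V (insert e E)" if "hamiltonian V E" for e E
    using that by (rule hamiltonian_mono) (rule subset_insertI)
  have "V \<noteq> {}" using assms by auto
  then have "capped_cover V 1 2 {}" by (rule capped_cover_empty)
  then show "hamiltonian V {} \<or> capped_cover V 1 2 {}" "hamiltonian V {} \<or> capped_cover V 2 3 {}"
    by (simp_all add: B_imp_A)
  have reply: "\<exists>e. legal_move V k (set es) e \<and>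
      (hamiltonian V (insert e (set es)) \<or> capped_cover V 1 2 (insert e (set es)))"
    if "play V k es" "capped_cover V 2 3 (set es)" "\<not> hamiltonian V (set es)" for es
    using reply_to_attack[OF that(2) assms(1) _ assms(4)] play_degree_le[OF that(1)] that(3) assms
    by simp
  show "\<exists>e'. legal_move V k (set es) e' \<and>
      (hamiltonian V (insert e' (set es)) \<or> capped_cover V 1 2 (insert e' (set es)))"
    if "play V k es" "hamiltonian V (set es) \<or> capped_cover V 2 3 (set es)"
      "legal_move V k (set es) e" for es e
  proof (cases "hamiltonian V (set es)")
    case True
    then show ?thesis using that(3) ham_insert by blast
  next
    case False
    then show ?thesis using reply[OF that(1)] that(2) by blast
  qed
  show "hamiltonian V (insert e (set es)) \<or> capped_cover V 2 3 (insert e (set es))"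
    if "hamiltonian V (set es) \<or> capped_cover V 1 2 (set es)" "legal_move V k (set es) e" for es e
    using that(1)
  proof
    assume "capped_cover V 1 2 (set es)"
    then show ?thesis
      using capped_cover_after_attack[of V "set es" e] that(2) by (simp add: legal_move_def)
  qed (simp add: ham_insert)
  \<comment> \<open>The game cannot end earlier, since the linking move is available whoever is to move.\<close>
  show "hamiltonian V (set es)"
    if "complete_play V k es" "(hamiltonian V (set es) \<or> capped_cover V 2 3 (set es)) \<or>
      hamiltonian V (set es) \<or> capped_cover V 1 2 (set es)" for es
  proof (rule ccontr)
    assume not_ham: "\<not> hamiltonian V (set es)"
    then have "capped_cover V 2 3 (set es)" using that(2) B_imp_A by blast
    then show False
      using reply[of es] not_ham that(1) unfolding complete_play_def by blast
  qed
qed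

end
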